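(* Let $n,a,b$ be positive integers. If $a<\frac{n}{2}$ and $b\ge n-2$, then the $(a:b)$ Maker-Breaker Connectivity game $\mathcal{T}_n$ is Breaker's win.
   Context: In the $(a:b)$ Maker-Breaker Connectivity game $\mathcal{T}_n$, the board is the edge set of the complete graph $K_n$. Two players, Maker and Breaker, alternately claim previously unclaimed edges, Breaker going first; in each turn Breaker claims $b$ edges and then Maker claims $a$ edges, until every edge is claimed. Maker wins if, by the end of the game, the graph of his edges is a connected spanning subgraph of $K_n$; otherwise Breaker wins. The game is Breaker's win if Breaker has a strategy that wins against every strategy of Maker. *)

theory Defs
  imports Complex_Main
begin

section \<open>Biased Maker-Breaker games on a finite board\<close>

text \<open>A history lists the edge sets claimed in the turns so far, in chronological order. Breaker
  moves first, so the entries at even positions are Breaker's and those at odd positions Maker's.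
  A strategy chooses the next move from the complete history.\<close>

type_synonym 'x strategy = "'x set list \<Rightarrow> 'x set"

definition unclaimed :: "'x set \<Rightarrow> 'x set list \<Rightarrow> 'x set" where
  "unclaimed X h = X - \<Union> (set h)"

text \<open>If fewer than \<open>q\<close> elements are left in the last turn, the player claims all of them.
  Strategies are required to be legal on all histories, including unreachable ones; this is no
  restriction, as a legal move exists after every history on a finite board.\<close>

definition legal_strategy :: "'x set \<Rightarrow> nat \<Rightarrow> 'x strategy \<Rightarrow> bool" where
  "legal_strategy X q \<sigma> \<longleftrightarrow>
     (\<forall>h. \<sigma> h \<subseteq> unclaimed X h \<and> card (\<sigma> h) = min q (card (unclaimed X h)))"

text \<open>\<open>play \<beta> \<mu> k\<close> is the history after \<open>k\<close> turns when Breaker plays \<open>\<beta>\<close> and Maker plays \<open>\<mu>\<close>.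
  Once the whole board is claimed, all further turns of a play are empty.\<close>

primrec play :: "'x strategy \<Rightarrow> 'x strategy \<Rightarrow> nat \<Rightarrow> 'x set list" where
  "play \<beta> \<mu> 0 = []"
| "play \<beta> \<mu> (Suc k) =
     play \<beta> \<mu> k @ [if even k then \<beta> (play \<beta> \<mu> k) else \<mu> (play \<beta> \<mu> k)]"

definition maker_claims :: "'x set list \<Rightarrow> 'x set" where
  "maker_claims h = (\<Union>i\<in>{i. i < length h \<and> odd i}. h ! i)"

text \<open>\<open>W\<close> is the property that Maker's set has to satisfy when the whole board is claimed.\<close>

definition maker_wins_play ::
  "'x set \<Rightarrow> ('x set \<Rightarrow> bool) \<Rightarrow> 'x strategy \<Rightarrow> 'x strategy \<Rightarrow> bool" where
  "maker_wins_play X W \<beta> \<mu> \<longleftrightarrow>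
     (\<exists>k. unclaimed X (play \<beta> \<mu> k) = {} \<and> W (maker_claims (play \<beta> \<mu> k)))"

definition breakers_win :: "'x set \<Rightarrow> ('x set \<Rightarrow> bool) \<Rightarrow> nat \<Rightarrow> nat \<Rightarrow> bool" where
  "breakers_win X W a b \<longleftrightarrow>
     (\<exists>\<beta>. legal_strategy X b \<beta> \<and>
       (\<forall>\<mu>. legal_strategy X a \<mu> \<longrightarrow> \<not> maker_wins_play X W \<beta> \<mu>))"


section \<open>The Connectivity game\<close>

definition complete_graph_edges :: "nat \<Rightarrow> nat set set" where
  "complete_graph_edges n = {e. e \<subseteq> {..<n} \<and> card e = 2}"

definition connected_spanning :: "nat \<Rightarrow> nat set set \<Rightarrow> bool" where
  "connected_spanning n F \<longleftrightarrow>
     F \<subseteq> complete_graph_edges n \<and>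
     (\<forall>u\<in>{..<n}. \<forall>v\<in>{..<n}. (u, v) \<in> {(x, y). {x, y} \<in> F}\<^sup>*)"

definition connectivity_game_breakers_win :: "nat \<Rightarrow> nat \<Rightarrow> nat \<Rightarrow> bool" where
  "connectivity_game_breakers_win n a b \<longleftrightarrow>
     breakers_win (complete_graph_edges n) (connected_spanning n) a b"

end

theory Submission
  imports Defs
begin

text \<open>Breaker isolates a vertex in his first two turns. He first claims all edges at \<open>0\<close> except
  possibly \<open>{0, 1}\<close>. If Maker does not answer with \<open>{0, 1}\<close>, Breaker takes it and \<open>0\<close> is isolated.
  Otherwise, as Maker's \<open>a\<close> edges cover fewer than \<open>n\<close> vertices, some vertex \<open>u \<noteq> 0, 1\<close> is free
  of Maker's edges; Breaker already owns \<open>{0, u}\<close>, so at most \<open>n - 2\<close> edges at \<open>u\<close> are left and he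
  claims all of them.\<close>

text \<open>Lets a plan name only the edges that matter: \<open>F h\<close> fits both into the quota
  and into the unclaimed set, so it can be padded to a move of exactly the legal size.\<close>

lemma legal_strategy_extending:
  assumes "finite X"
    and "\<And>h. F h \<subseteq> unclaimed X h" and "\<And>h. card (F h) \<le> q"
  obtains \<sigma> where "legal_strategy X q \<sigma>" and "\<And>h. F h \<subseteq> \<sigma> h"
proof -
  have "\<exists>S. F h \<subseteq> S \<and> S \<subseteq> unclaimed X h \<and> card S = min q (card (unclaimed X h))" for h
  proof -
    have fin: "finite (unclaimed X h)"
      using assms(1) by (simp add: unclaimed_def)
    have "card (F h) \<le> min q (card (unclaimed X h))"
      using assms(3)[of h] card_mono[OF fin assms(2)] by simp
    then show ?thesis
      using exists_subset_between[of "F h" "min q (card (unclaimed X h))" "unclaimed X h"]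
        assms(2)[of h] fin by auto
  qed
  then obtain \<sigma> where
    "\<And>h. F h \<subseteq> \<sigma> h \<and> \<sigma> h \<subseteq> unclaimed X h \<and> card (\<sigma> h) = min q (card (unclaimed X h))"
    by metis
  then show thesis
    by (intro that[of \<sigma>]) (simp_all add: legal_strategy_def)
qed

lemma length_play [simp]: "length (play \<beta> \<mu> k) = k"
  by (induction k) auto

lemma maker_claims_Nil [simp]: "maker_claims [] = {}"
  by (simp add: maker_claims_def)

lemma maker_claims_snoc:
  "maker_claims (h @ [A]) = maker_claims h \<union> (if odd (length h) then A else {})"
proof -
  have "{i. i < length (h @ [A]) \<and> odd i} =
      {i. i < length h \<and> odd i} \<union> (if odd (length h) then {length h} else {})"
    by (auto simp: less_Suc_eq)
  then show ?thesis
    by (auto simp: maker_claims_def nth_append)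
qed

lemma maker_claims_play_Suc:
  "maker_claims (play \<beta> \<mu> (Suc k)) =
     maker_claims (play \<beta> \<mu> k) \<union> (if odd k then \<mu> (play \<beta> \<mu> k) else {})"
  by (simp add: maker_claims_snoc)

lemma maker_claims_play_mono:
  "j \<le> k \<Longrightarrow> maker_claims (play \<beta> \<mu> j) \<subseteq> maker_claims (play \<beta> \<mu> k)"
  by (induction k rule: dec_induct) (auto simp: maker_claims_play_Suc simp del: play.simps)

lemma set_play_mono:
  "j \<le> k \<Longrightarrow> set (play \<beta> \<mu> j) \<subseteq> set (play \<beta> \<mu> k)"
  by (induction k rule: dec_induct) auto

text \<open>Maker can only take unclaimed elements, so once \<open>S\<close> is used up without him,
  he never gets any of it. This carries the position after Breaker's second turn to the end of the
  play.\<close>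

lemma maker_claims_play_disjoint:
  assumes "legal_strategy X a \<mu>"
    and "S \<inter> maker_claims (play \<beta> \<mu> j) = {}" and "S \<subseteq> \<Union> (set (play \<beta> \<mu> j))"
  shows "S \<inter> maker_claims (play \<beta> \<mu> k) = {}"
proof (cases "k \<le> j")
  case True
  then show ?thesis
    using maker_claims_play_mono[of k j \<beta> \<mu>] assms(2) by blast
next
  case False
  then have "j \<le> k" by simp
  then show ?thesis
  proof (induction k rule: dec_induct)
    case base
    show ?case by (fact assms(2))
  next
    case (step m)
    have "\<mu> (play \<beta> \<mu> m) \<inter> \<Union> (set (play \<beta> \<mu> m)) = {}"
      using assms(1) unfolding legal_strategy_def unclaimed_def by blast
    then have "S \<inter> \<mu> (play \<beta> \<mu> m) = {}"
      using assms(3) set_play_mono[OF step.hyps(1), of \<beta> \<mu>] by blast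
    then show ?case
      using step.IH by (auto simp: maker_claims_play_Suc simp del: play.simps)
  qed
qed

lemma finite_complete_graph_edges [simp]: "finite (complete_graph_edges n)"
  by (rule finite_subset[of _ "Pow {..<n}"]) (auto simp: complete_graph_edges_def)

definition edges_at :: "nat \<Rightarrow> nat \<Rightarrow> nat set set" where
  "edges_at n v = {e \<in> complete_graph_edges n. v \<in> e}"

lemma finite_edges_at [simp]: "finite (edges_at n v)"
  by (simp add: edges_at_def)

lemma pair_in_edges_at: "v < n \<Longrightarrow> w < n \<Longrightarrow> v \<noteq> w \<Longrightarrow> {v, w} \<in> edges_at n v"
  by (auto simp: edges_at_def complete_graph_edges_def)

lemma edges_at_eq_image:
  assumes "v < n"
  shows "edges_at n v = (\<lambda>w. {v, w}) ` ({..<n} - {v})"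
proof
  show "edges_at n v \<subseteq> (\<lambda>w. {v, w}) ` ({..<n} - {v})"
  proof
    fix e assume "e \<in> edges_at n v"
    then have e: "e \<subseteq> {..<n}" "card e = 2" "v \<in> e"
      by (auto simp: edges_at_def complete_graph_edges_def)
    from e(2) obtain x y where "e = {x, y}" "x \<noteq> y"
      by (auto simp: card_2_iff)
    with e show "e \<in> (\<lambda>w. {v, w}) ` ({..<n} - {v})"
      by (cases "v = x") (auto simp: insert_commute)
  qed
qed (use assms pair_in_edges_at in auto)

lemma card_edges_at:
  assumes "v < n"
  shows "card (edges_at n v) = n - 1"
proof -
  have "inj_on (\<lambda>w. {v, w}) ({..<n} - {v})"
    by (auto simp: inj_on_def doubleton_eq_iff)
  then show ?thesis
    using assms by (simp add: edges_at_eq_image card_image)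
qed

text \<open>A path from \<open>v\<close> to a second vertex, which exists by
  \<open>2 \<le> n\<close>, has to start with an edge at \<open>v\<close>.\<close>

lemma not_connected_spanning_if_isolated:
  assumes "v < n" and "2 \<le> n" and "edges_at n v \<inter> F = {}"
  shows "\<not> connected_spanning n F"
proof
  assume F: "connected_spanning n F"
  obtain w where w: "w < n" "w \<noteq> v"
    using assms(2) by (metis less_le_trans one_less_numeral_iff pos2 semiring_norm(76) zero_neq_one)
  then have "(v, w) \<in> {(x, y). {x, y} \<in> F}\<^sup>*"
    using F assms(1) by (auto simp: connected_spanning_def)
  then obtain y where "{v, y} \<in> F"
    using w(2) by (auto elim: converse_rtranclE)
  then show False
    using F assms(3) by (auto simp: connected_spanning_def edges_at_def)
qed

text \<open>Each edge has two ends, so \<open>\<Union> M\<close> has at most \<open>2 * a\<close>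
  elements.\<close>

lemma exists_uncovered_vertex:
  assumes "M \<subseteq> complete_graph_edges n" and "card M \<le> a" and "2 * a < n"
  obtains u where "u < n" and "edges_at n u \<inter> M = {}"
proof -
  have fin: "finite M"
    using assms(1) finite_complete_graph_edges by (rule finite_subset)
  have "card (\<Union> M) \<le> (\<Sum>e\<in>M. card e)"
    by (rule card_Union_le_sum_card)
  also have "\<dots> = (\<Sum>e\<in>M. 2)"
    using assms(1) by (intro sum.cong) (auto simp: complete_graph_edges_def)
  also have "\<dots> < card {..<n}"
    using assms(2,3) by simp
  finally have "card (\<Union> M) < card {..<n}" .
  moreover have "\<Union> M \<subseteq> {..<n}"
    using assms(1) by (auto simp: complete_graph_edges_def)
  ultimately have "\<Union> M \<subset> {..<n}"
    by auto
  then obtain u where "u < n" "u \<notin> \<Union> M"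
    by blast
  then show thesis
    by (intro that) (auto simp: edges_at_def)
qed

theorem theorem1p3:
  fixes n a b :: nat
  assumes "n > 0" and "a > 0" and "b > 0"
    and "real a < real n / 2"
    and "int b \<ge> int n - 2"
  shows "connectivity_game_breakers_win n a b"
proof -
  have a: "2 * a < n" and n: "3 \<le> n" and b: "n - 2 \<le> b"
    using assms by linarith+
  let ?X = "complete_graph_edges n"
  \<comment> \<open>These are the vertices \<open>z\<close> that Breaker can isolate in a single
    turn after \<open>h\<close>.\<close>
  define goal where "goal h z \<longleftrightarrow> z < n \<and> edges_at n z \<inter> maker_claims h = {} \<and>
    card (edges_at n z \<inter> unclaimed ?X h) \<le> b" for h z
  \<comment> \<open>A plan is required on every history, including unreachable ones;
    \<open>{}\<close> is the default where no vertex can be isolated at once.\<close>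
  define F where "F h = (if h = [] then edges_at n 0 - {{0, 1}}
    else if \<exists>z. goal h z then edges_at n (SOME z. goal h z) \<inter> unclaimed ?X h else {})" for h
  have F_unclaimed: "F h \<subseteq> unclaimed ?X h" for h
    by (auto simp: F_def unclaimed_def edges_at_def)
  have card_F: "card (F h) \<le> b" for h
  proof (cases "h = []")
    case True
    have "{0, 1} \<in> edges_at n 0"
      using n by (intro pair_in_edges_at) auto
    \<comment> \<open>Of the \<open>n - 1\<close> edges at \<open>0\<close>, exactly one is left
      out.\<close>
    then have "card (F h) = n - 2"
      using True n by (simp add: F_def card_edges_at card_Diff_singleton)
    with b show ?thesis by simp
  next
    case False
    have "card (edges_at n (SOME z. goal h z) \<inter> unclaimed ?X h) \<le> b" if "\<exists>z. goal h z"
      using someI_ex[OF that] by (simp only: goal_def)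
    with False show ?thesis by (simp add: F_def)
  qed
  obtain \<beta> where legal: "legal_strategy ?X b \<beta>" and F: "\<And>h. F h \<subseteq> \<beta> h"
    by (rule legal_strategy_extending[OF finite_complete_graph_edges F_unclaimed card_F])
      (simp add: that)
  have "\<not> maker_wins_play ?X (connected_spanning n) \<beta> \<mu>" if \<mu>: "legal_strategy ?X a \<mu>" for \<mu>
  proof -
    define B where "B = \<beta> []"
    define M where "M = \<mu> [B]"
    define h where "h = play \<beta> \<mu> 2"
    have h: "h = [B, M]"
      by (simp add: h_def numeral_2_eq_2 B_def M_def)
    have M_claims: "maker_claims h = M"
      using maker_claims_snoc[of "[B]" M] maker_claims_snoc[of "[]" B] by (simp add: h)
    have B: "edges_at n 0 - {{0, 1}} \<subseteq> B"
      using F[of "[]"] by (simp add: B_def F_def)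
    have M: "M \<subseteq> unclaimed ?X [B]" "card M \<le> a"
      using \<mu> by (auto simp: M_def legal_strategy_def)
    have "\<exists>z. goal h z"
    proof (cases "{0, 1} \<in> M")
      case True
      have "M \<subseteq> ?X"
        using M(1) by (auto simp: unclaimed_def)
      then obtain u where u: "u < n" "edges_at n u \<inter> M = {}"
        using exists_uncovered_vertex[OF _ M(2) a] by blast
      \<comment> \<open>Maker's edge \<open>{0, 1}\<close> covers both \<open>0\<close> and
        \<open>1\<close>.\<close>
      have u_neq: "u \<noteq> 0" "u \<noteq> 1"
        using True u(2) \<open>M \<subseteq> ?X\<close> by (auto simp: edges_at_def)
      have u0: "{0, u} \<in> edges_at n u"
        using pair_in_edges_at[of u n 0] u(1) u_neq(1) n by (simp add: insert_commute)
      have "{0, u} \<in> edges_at n 0 - {{0, 1}}"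
        using pair_in_edges_at[of 0 n u] u(1) u_neq by (simp add: doubleton_eq_iff)
      with B have "{0, u} \<in> B"
        by (rule subsetD)
      then have "card (edges_at n u \<inter> unclaimed ?X h) \<le> card (edges_at n u - {{0, u}})"
        by (intro card_mono) (auto simp: unclaimed_def h)
      also have "\<dots> = n - 2"
        using u0 u(1) by (simp add: card_Diff_singleton card_edges_at)
      finally show ?thesis
        using u b M_claims by (auto simp: goal_def)
    next
      case False
      \<comment> \<open>Here \<open>z = 0\<close> works: at most one edge at \<open>0\<close> is
        left, and \<open>b > 0\<close> allows Breaker to take it. The padding of his first move may
        already contain it.\<close>
      have "edges_at n 0 \<inter> unclaimed ?X h \<subseteq> {{0, 1}}"
        using B by (auto simp: unclaimed_def h)
      then have "card (edges_at n 0 \<inter> unclaimed ?X h) \<le> card {{0, 1 :: nat}}"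
        by (intro card_mono) auto
      moreover have "edges_at n 0 \<inter> M = {}"
        using B M(1) False by (auto simp: unclaimed_def)
      ultimately show ?thesis
        using assms(1,3) M_claims by (auto simp: goal_def intro!: exI[of _ 0])
    qed
    \<comment> \<open>This is the same choice as in \<open>F\<close>, so Breaker's reply to
      \<open>h\<close> contains all unclaimed edges at this \<open>z\<close>.\<close>
    moreover define z where "z = (SOME z. goal h z)"
    ultimately have z: "goal h z" and Fz: "F h = edges_at n z \<inter> unclaimed ?X h"
      using h by (auto simp: F_def intro: someI_ex)
    have play3: "play \<beta> \<mu> 3 = h @ [\<beta> h]"
      by (simp add: h_def eval_nat_numeral)
    \<comment> \<open>The new entry has the even index 2, so it is Breaker's and leaves Maker's
      claims unchanged.\<close>
    have "edges_at n z \<inter> maker_claims (play \<beta> \<mu> 3) = {}"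
      using z by (simp add: play3 maker_claims_snoc goal_def) (simp add: h)
    \<comment> \<open>An edge at \<open>z\<close> was either claimed in \<open>h\<close> or belongs
      to \<open>F h\<close>, hence to \<open>\<beta> h\<close>.\<close>
    moreover have "edges_at n z \<subseteq> \<Union> (set (play \<beta> \<mu> 3))"
      using F[of h] by (auto simp: play3 Fz unclaimed_def edges_at_def)
    ultimately have "edges_at n z \<inter> maker_claims (play \<beta> \<mu> k) = {}" for k
      by (rule maker_claims_play_disjoint[OF \<mu>])
    then show ?thesis
      using not_connected_spanning_if_isolated[of z n] z n
      by (auto simp: maker_wins_play_def goal_def)
  qed
  with legal show ?thesis
    by (auto simp: connectivity_game_breakers_win_def breakers_win_def)
qed

end
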